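(* Let $\phi_\lambda$ be a (possibly non-convex) regularizer with proximal operator $h$, and suppose there is a constant $0<c<\infty$ such that either $|h(z)|\le c|z|$ for all $z\in\mathbb{R}$, or $|h(z)|\le c$ for all $z\in\mathbb{R}$. Let $x\in\mathbb{R}^d$, let $f_0\in\mathcal{F}$, and define for $t\ge 0$ $$f_{t+1}=h\big(\mathcal{A}^*(x)+f_t-\mathcal{A}^*(\mathcal{A}(f_t))\big),$$ i.e. $f_{t+1}(w)=h\big(w^\top x+f_t(w)-w^\top\mathbb{E}_{w'}[w'f_t(w')]\big)$. Let $$Q(f)=\tfrac12\|x-\mathcal{A}(f)\|_2^2+\mathbb{E}_{w}[\phi_\lambda(f(w))].$$ Then for all $t\ge 0$, $$Q(f_{t+1})\le Q(f_t)-\tfrac12\,\mathbb{E}_{w}\Big[\Big(f_{t+1}(w)-f_t(w)-w^\top\mathbb{E}_{w'}\big[w'(f_{t+1}(w')-f_t(w'))\big]\Big)^2\Big]\le Q(f_t).$$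
   Context: Fix $d\ge1$. One of two settings is fixed: either $w\sim\mathcal{N}(0,I_d)$ and $\mathcal{F}=\{f:\mathbb{E}_{w}[f(w)^2]<\infty\}$ (Gaussian square-integrable functions), or $w$ is uniform on the sphere $\sqrt d\,\mathbb{S}^{d-1}\subset\mathbb{R}^d$ of radius $\sqrt d$ and $\mathcal{F}=\{f:\mathbb{E}_{w}[f(w)^2]<\infty\}$ (functions real-valued and measurable). In both settings $\mathcal{A}(f)=\mathbb{E}_w[w f(w)]\in\mathbb{R}^d$ for $f\in\mathcal{F}$, and $\mathcal{A}^*(x)$ is the function $w\mapsto w^\top x$. The regularizer $\phi_\lambda:\mathbb{R}\to(-\infty,+\infty]$ is a measurable function (depending on a parameter $\lambda$), bounded from below, such that $\mathbb{E}_w[\phi_\lambda(f(w))]$ is finite for some $f\in\mathcal{F}$; expectations of $\phi_\lambda$ take values in $(-\infty,+\infty]$. Its proximal operator is $h(z)=\arg\min_{u\in\mathbb{R}}\{\frac12(u-z)^2+\phi_\lambda(u)\}$; a minimizer is assumed to exist for every $z$, and $h$ is a measurable choice of minimizer. *)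

theory Defs
  imports "HOL-Probability.Probability"
begin

section \<open>The two input distributions\<close>

text \<open>The law \<open>N(0, I\<^sub>d)\<close>, given by its Lebesgue density.\<close>

definition std_gaussian :: "(real ^ 'n) measure" where
  "std_gaussian = density lborel (\<lambda>w. ennreal (\<Prod>i\<in>UNIV. std_normal_density (w $ i)))"

text \<open>
  The uniform distribution on the sphere of radius \<open>sqrt d\<close>, i.e. its normalized surface measure:
  the probability of a Borel subset \<open>S\<close> of the sphere is the fraction of the unit ball
  that is occupied by the cone over \<open>S\<close>. The origin, which is not mapped to the sphere,
  is a null set. The underlying space of the measure is the sphere itself, so
  measurability and integrability say nothing about values off the sphere.
  The lemma \<open>sphere_uniform_invariant\<close> below shows that this probability
  measure is invariant under the full orthogonal group.
\<close>

definition sphere_uniform :: "(real ^ 'n) measure" where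
  "sphere_uniform =
     restrict_space
       (distr (uniform_measure lborel (ball 0 1)) borel
          (\<lambda>v. (sqrt (real CARD('n)) / norm v) *\<^sub>R v))
       (sphere 0 (sqrt (real CARD('n))))"

section \<open>The functional setting\<close>

definition sq_integrable_funs :: "'a measure \<Rightarrow> ('a \<Rightarrow> real) set" where
  "sq_integrable_funs M = {f \<in> borel_measurable M. integrable M (\<lambda>w. (f w)\<^sup>2)}"

definition meas_op :: "(real ^ 'n) measure \<Rightarrow> (real ^ 'n \<Rightarrow> real) \<Rightarrow> real ^ 'n" where
  "meas_op M f = (\<integral>w. f w *\<^sub>R w \<partial>M)"

definition meas_adj :: "real ^ 'n \<Rightarrow> real ^ 'n \<Rightarrow> real" where
  "meas_adj x w = w \<bullet> x"

text \<open>
  Expectation with values in \<open>(-\<infinity>, \<infinity>]\<close>, as the difference of the integrals of the positive and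
  the negative part (\<^const>\<open>e2ennreal\<close> truncates negative values to zero). It is only used for
  functions that are bounded from below on a probability space, where the second
  integral is finite.
\<close>

definition ereal_expectation :: "'a measure \<Rightarrow> ('a \<Rightarrow> ereal) \<Rightarrow> ereal" where
  "ereal_expectation M g =
     enn2ereal (\<integral>\<^sup>+ w. e2ennreal (g w) \<partial>M) - enn2ereal (\<integral>\<^sup>+ w. e2ennreal (- g w) \<partial>M)"

definition is_regularizer :: "(real ^ 'n) measure \<Rightarrow> (real \<Rightarrow> ereal) \<Rightarrow> bool" where
  "is_regularizer M \<phi> \<longleftrightarrow>
     \<phi> \<in> borel_measurable borel \<and>
     (\<exists>b::real. \<forall>u. ereal b \<le> \<phi> u) \<and>
     (\<exists>f \<in> sq_integrable_funs M. \<bar>ereal_expectation M (\<lambda>w. \<phi> (f w))\<bar> \<noteq> \<infinity>)"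

definition is_prox :: "(real \<Rightarrow> ereal) \<Rightarrow> (real \<Rightarrow> real) \<Rightarrow> bool" where
  "is_prox \<phi> h \<longleftrightarrow>
     h \<in> borel_measurable borel \<and>
     (\<forall>z. is_arg_min (\<lambda>u. ereal (1/2 * (u - z)\<^sup>2) + \<phi> u) (\<lambda>u. True) (h z))"

definition objective ::
  "(real ^ 'n) measure \<Rightarrow> (real \<Rightarrow> ereal) \<Rightarrow> real ^ 'n \<Rightarrow> (real ^ 'n \<Rightarrow> real) \<Rightarrow> ereal" where
  "objective M \<phi> x f =
     ereal (1/2 * (norm (x - meas_op M f))\<^sup>2) + ereal_expectation M (\<lambda>w. \<phi> (f w))"

section \<open>Basic facts about the two distributions\<close>

lemma space_std_gaussian: "space std_gaussian = UNIV"
  by (simp add: std_gaussian_def)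

lemma sets_std_gaussian: "sets std_gaussian = sets borel"
  by (simp add: std_gaussian_def)

lemma space_sphere_uniform:
  "space (sphere_uniform :: (real ^ 'n) measure) = sphere 0 (sqrt (real CARD('n)))"
  by (simp add: sphere_uniform_def space_restrict_space)

lemma sets_sphere_uniform:
  "sets (sphere_uniform :: (real ^ 'n) measure) =
     sets (restrict_space borel (sphere 0 (sqrt (real CARD('n)))))"
  unfolding sphere_uniform_def by (rule sets_restrict_space_cong) simp

lemma prob_space_std_gaussian: "prob_space (std_gaussian :: (real ^ 'n) measure)"
proof
  let ?b = "\<lambda>i. axis i 1 :: real ^ 'n"
  let ?P = "\<Pi>\<^sub>M b\<in>(Basis :: (real ^ 'n) set). (lborel :: real measure)"
  interpret product_sigma_finite "\<lambda>b :: real ^ 'n. lborel :: real measure"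
    by standard
  have inj: "inj ?b"
    by (auto intro!: injI simp: axis_eq_axis)
  have Basis_eq: "(Basis :: (real ^ 'n) set) = range ?b"
    by (auto simp: Basis_vec_def)
  have prod_eq: "(\<Prod>i\<in>UNIV. std_normal_density (w $ i)) =
      (\<Prod>b\<in>Basis. std_normal_density (w \<bullet> b))" for w :: "real ^ 'n"
    unfolding Basis_eq using inj by (simp add: prod.reindex inner_axis)
  have one: "(\<integral>\<^sup>+ y. ennreal (std_normal_density y) \<partial>lborel) = 1"
    by (simp add: nn_integral_eq_integral normal_density_nonneg)
  have "emeasure (std_gaussian :: (real ^ 'n) measure) (space std_gaussian) =
      (\<integral>\<^sup>+ w. (\<Prod>b\<in>Basis. ennreal (std_normal_density ((w :: real ^ 'n) \<bullet> b))) \<partial>lborel)"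
    unfolding std_gaussian_def prod_eq
    by (simp add: emeasure_density prod_ennreal normal_density_nonneg)
  also have "\<dots> = (\<integral>\<^sup>+ f. (\<Prod>b\<in>Basis. ennreal (std_normal_density (f b))) \<partial>?P)"
    unfolding lborel_eq[where 'a = "real ^ 'n"]
    by (subst nn_integral_distr) (auto intro!: nn_integral_cong prod.cong)
  also have "\<dots> = (\<Prod>b\<in>(Basis :: (real ^ 'n) set). (\<integral>\<^sup>+ y. ennreal (std_normal_density y) \<partial>lborel))"
    by (rule product_nn_integral_prod) auto
  also have "\<dots> = 1"
    by (simp add: one)
  finally show "emeasure (std_gaussian :: (real ^ 'n) measure) (space std_gaussian) = 1" .
qed

lemma orthogonal_transformation_borel_measurable:
  fixes T :: "'a :: euclidean_space \<Rightarrow> 'a"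
  assumes "orthogonal_transformation T"
  shows "T \<in> borel \<rightarrow>\<^sub>M borel"
  using orthogonal_transformation_linear[OF assms]
  by (intro borel_measurable_continuous_onI linear_continuous_on)
     (simp add: linear_conv_bounded_linear)

text \<open>
  Lebesgue measure is invariant under orthogonal maps. The library's version of this needs a
  well-ordered index type, so we use the uniqueness argument for translation invariant measures.
\<close>

lemma emeasure_lborel_orthogonal_vimage:
  fixes T :: "'a :: euclidean_space \<Rightarrow> 'a"
  assumes T: "orthogonal_transformation T" and A: "A \<in> sets borel"
  shows "emeasure lborel (T -` A) = emeasure lborel A"
proof -
  let ?B = "ball 0 1 :: 'a set"
  let ?i = "\<lambda>S z. indicator S z :: ennreal"
  note [measurable] = orthogonal_transformation_borel_measurable[OF T] A
  have TA: "T -` A \<in> sets borel"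
    using measurable_sets[OF orthogonal_transformation_borel_measurable[OF T] A] by simp
  have TB: "T -` ?B = ?B"
    using T by (auto simp: orthogonal_transformation_norm)
  have B [measurable]: "?B \<in> sets borel"
    by simp
  have ind: "?i S (T v) = ?i (T -` S) v" for S v
    by (simp add: indicator_def)
  have plus: "(\<integral>\<^sup>+ y. g (a + y) \<partial>lborel) = (\<integral>\<^sup>+ y. g y \<partial>lborel)"
    if [measurable]: "g \<in> borel_measurable borel" for g :: "'a \<Rightarrow> ennreal" and a
    using nn_integral_distr[of "(+) a" lborel borel g] by (simp add: lborel_distr_plus)
  have neg: "(\<integral>\<^sup>+ y. g (- y) \<partial>lborel) = (\<integral>\<^sup>+ y. g y \<partial>lborel)"
    if [measurable]: "g \<in> borel_measurable borel" for g :: "'a \<Rightarrow> ennreal"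
    by (subst (2) lborel_affine[of "-1" 0]) (simp_all add: nn_integral_density nn_integral_distr)
  have inner1: "(\<integral>\<^sup>+ y. ?i ?B (a + y) \<partial>lborel) = emeasure lborel ?B" for a
    by (subst plus) (auto intro!: borel_measurable_indicator)
  have inner2: "(\<integral>\<^sup>+ y. ?i A (a - y) \<partial>lborel) = emeasure lborel A" for a
    using neg[of "\<lambda>y. ?i A (a + y)"] plus[of "?i A" a] A by simp
  have shift: "(\<integral>\<^sup>+ v. ?i A (T v) * ?i ?B (T v + y) \<partial>lborel) =
      (\<integral>\<^sup>+ v. ?i A (T v - y) * ?i ?B (T v) \<partial>lborel)" for y
  proof -
    obtain u where u: "T u = y"
      using orthogonal_transformation_surj[OF T] by (metis surjD)
    have "T (u + v) = y + T v" for v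
      using linear_add[OF orthogonal_transformation_linear[OF T]] u by simp
    moreover have "(\<lambda>v. ?i A (T v - y) * ?i ?B (T v)) \<in> borel_measurable borel"
      by measurable
    ultimately show ?thesis
      using plus[of "\<lambda>v. ?i A (T v - y) * ?i ?B (T v)" u] by (simp add: add.commute)
  qed
  have "emeasure lborel (T -` A) * emeasure lborel ?B =
      (\<integral>\<^sup>+ v. ?i A (T v) * (\<integral>\<^sup>+ y. ?i ?B (T v + y) \<partial>lborel) \<partial>lborel)"
    unfolding inner1 unfolding ind using TA by (simp add: nn_integral_multc)
  also have "\<dots> = (\<integral>\<^sup>+ v. \<integral>\<^sup>+ y. ?i A (T v) * ?i ?B (T v + y) \<partial>lborel \<partial>lborel)"
    by (intro nn_integral_cong nn_integral_cmult[symmetric]) measurable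
  also have "\<dots> = (\<integral>\<^sup>+ y. \<integral>\<^sup>+ v. ?i A (T v) * ?i ?B (T v + y) \<partial>lborel \<partial>lborel)"
    by (rule lborel_pair.Fubini'[symmetric]) measurable
  also have "\<dots> = (\<integral>\<^sup>+ y. \<integral>\<^sup>+ v. ?i A (T v - y) * ?i ?B (T v) \<partial>lborel \<partial>lborel)"
    by (simp only: shift)
  also have "\<dots> = (\<integral>\<^sup>+ v. \<integral>\<^sup>+ y. ?i A (T v - y) * ?i ?B (T v) \<partial>lborel \<partial>lborel)"
    by (rule lborel_pair.Fubini') measurable
  also have "\<dots> = (\<integral>\<^sup>+ v. (\<integral>\<^sup>+ y. ?i A (T v - y) \<partial>lborel) * ?i ?B (T v) \<partial>lborel)"
    by (intro nn_integral_cong nn_integral_multc) measurable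
  also have "\<dots> = emeasure lborel A * emeasure lborel ?B"
    unfolding inner2 unfolding ind TB by (simp add: nn_integral_cmult)
  finally have "emeasure lborel (T -` A) * emeasure lborel ?B = emeasure lborel A * emeasure lborel ?B" .
  moreover have "emeasure lborel ?B \<noteq> 0" "emeasure lborel ?B \<noteq> \<infinity>"
    using less_imp_neq[OF unit_ball_vol_pos[of "real DIM('a)"]] by (simp_all add: emeasure_ball)
  ultimately show ?thesis
    by (metis mult_divide_eq_ennreal infinity_ennreal_def)
qed

lemma emeasure_ball_orthogonal_vimage:
  fixes T :: "'a :: euclidean_space \<Rightarrow> 'a"
  assumes T: "orthogonal_transformation T" and S: "S \<in> sets borel"
  shows "emeasure lborel (ball 0 1 \<inter> T -` S) = emeasure lborel (ball 0 1 \<inter> S)"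
proof -
  have "ball 0 1 \<inter> T -` S = T -` (ball 0 1 \<inter> S)"
    using T by (auto simp: orthogonal_transformation_norm)
  with emeasure_lborel_orthogonal_vimage[OF T, of "ball 0 1 \<inter> S"] S show ?thesis
    by simp
qed

abbreviation (input) to_sphere :: "real ^ 'n \<Rightarrow> real ^ 'n" where
  "to_sphere v \<equiv> (sqrt (real CARD('n)) / norm v) *\<^sub>R v"

lemma emeasure_sphere_uniform:
  fixes S :: "(real ^ 'n) set"
  assumes S: "S \<in> sets borel" and sub: "S \<subseteq> sphere 0 (sqrt (real CARD('n)))"
  shows "emeasure sphere_uniform S =
    emeasure lborel (ball 0 1 \<inter> to_sphere -` S) / emeasure lborel (ball (0 :: real ^ 'n) 1)"
proof -
  have m: "to_sphere \<in> borel \<rightarrow>\<^sub>M borel"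
    by measurable
  have "to_sphere -` S \<in> sets borel"
    using measurable_sets[OF m S] by simp
  then show ?thesis
    unfolding sphere_uniform_def using S sub
    by (subst emeasure_restrict_space) (auto simp: emeasure_distr)
qed

lemma prob_space_sphere_uniform: "prob_space (sphere_uniform :: (real ^ 'n) measure)"
proof
  let ?S = "sphere 0 (sqrt (real CARD('n))) :: (real ^ 'n) set"
  let ?B = "ball 0 1 :: (real ^ 'n) set"
  have eq: "?B \<inter> to_sphere -` ?S = ?B - {0}"
    by auto
  have "emeasure lborel (?B - {0}) = emeasure lborel ?B"
    by (intro emeasure_Diff_null_set) auto
  moreover have "emeasure lborel ?B \<noteq> 0"
    using less_imp_neq[OF unit_ball_vol_pos[of "real CARD('n)"]] by (simp add: emeasure_ball)
  moreover have "emeasure lborel ?B \<noteq> \<infinity>"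
    by (simp add: emeasure_ball)
  ultimately show "emeasure (sphere_uniform :: (real ^ 'n) measure) (space sphere_uniform) = 1"
    by (simp add: space_sphere_uniform emeasure_sphere_uniform eq ennreal_divide_self top.not_eq_extremum)
qed

lemma sphere_uniform_invariant:
  fixes T :: "real ^ 'n \<Rightarrow> real ^ 'n"
  assumes T: "orthogonal_transformation T"
  shows "distr sphere_uniform sphere_uniform T = sphere_uniform"
proof (rule measure_eqI)
  fix A :: "(real ^ 'n) set"
  let ?S = "sphere 0 (sqrt (real CARD('n))) :: (real ^ 'n) set"
  have TS: "T -` ?S = ?S"
    using T by (auto simp: orthogonal_transformation_norm)
  have mT: "T \<in> sphere_uniform \<rightarrow>\<^sub>M sphere_uniform"
    unfolding measurable_cong_sets[OF sets_sphere_uniform sets_sphere_uniform]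
    using orthogonal_transformation_borel_measurable[OF T] TS
    by (intro measurable_restrict_space3) auto
  assume "A \<in> sets (distr sphere_uniform sphere_uniform T)"
  then have A: "A \<in> sets borel" "A \<subseteq> ?S"
    by (auto simp: sets_sphere_uniform sets_restrict_space_iff)
  have TA: "T -` A \<in> sets borel" "T -` A \<subseteq> ?S"
    using measurable_sets[OF orthogonal_transformation_borel_measurable[OF T] A(1)] A(2) TS by auto
  have m: "to_sphere \<in> borel \<rightarrow>\<^sub>M borel"
    by measurable
  have PA: "to_sphere -` A \<in> sets borel"
    using measurable_sets[OF m A(1)] by simp
  have comm: "to_sphere -` (T -` A) = T -` (to_sphere -` A)"
    using T by (auto simp: orthogonal_transformation_norm
        linear_scale[OF orthogonal_transformation_linear[OF T]])
  have "emeasure (distr sphere_uniform sphere_uniform T) A = emeasure sphere_uniform (T -` A)"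
    using mT A TA(2)
    by (subst emeasure_distr)
       (auto simp: sets_sphere_uniform sets_restrict_space_iff space_sphere_uniform Int_absorb2)
  also have "\<dots> = emeasure sphere_uniform A"
    unfolding emeasure_sphere_uniform[OF TA] emeasure_sphere_uniform[OF A] comm
    by (simp only: emeasure_ball_orthogonal_vimage[OF T PA])
  finally show "emeasure (distr sphere_uniform sphere_uniform T) A = emeasure sphere_uniform A" .
qed simp

end

theory Submission
  imports Defs
begin

text \<open>
  Both input distributions are isotropic, \<open>E[w w\<^sup>T] = I\<close>, so that \<open>A A\<^sup>* = I\<close>. With
  \<open>r = x - A f\<close>, the argument of the proximal operator is \<open>z = f + A\<^sup>* r\<close>, and with
  \<open>\<delta> = f\<^sub>+ - f\<close> isotropy gives
  \<open>E[(f\<^sub>+ - z)\<^sup>2] = \<parallel>x - A f\<^sub>+\<parallel>\<^sup>2 + E[(\<delta> - A\<^sup>* A \<delta>)\<^sup>2]\<close> and \<open>E[(f - z)\<^sup>2] = \<parallel>x - A f\<parallel>\<^sup>2\<close>.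
  Hence the claim is the expectation of the pointwise proximal inequality
  \<open>(f\<^sub>+ - z)\<^sup>2 / 2 + \<phi> f\<^sub>+ \<le> (f - z)\<^sup>2 / 2 + \<phi> f\<close>. The growth condition on \<open>h\<close> is what keeps
  the iterates square integrable.
\<close>

section \<open>Square-integrable functions\<close>

lemma sq_integrable_funsD:
  assumes "f \<in> sq_integrable_funs M"
  shows "f \<in> borel_measurable M" "integrable M (\<lambda>w. (f w)\<^sup>2)"
  using assms by (auto simp: sq_integrable_funs_def)

lemma integrable_mult_sq_integrable_funs:
  assumes f: "f \<in> sq_integrable_funs M" and g: "g \<in> sq_integrable_funs M"
  shows "integrable M (\<lambda>w. f w * g w)"
proof (rule Bochner_Integration.integrable_bound)
  note [measurable] = sq_integrable_funsD(1)[OF f] sq_integrable_funsD(1)[OF g]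
  show "integrable M (\<lambda>w. (f w)\<^sup>2 + (g w)\<^sup>2)"
    using sq_integrable_funsD(2)[OF f] sq_integrable_funsD(2)[OF g] by simp
  show "(\<lambda>w. f w * g w) \<in> borel_measurable M"
    by measurable
  have "\<bar>a * b\<bar> \<le> a\<^sup>2 + b\<^sup>2" for a b :: real
  proof -
    have "0 \<le> (\<bar>a\<bar> - \<bar>b\<bar>)\<^sup>2" by simp
    then have "2 * (\<bar>a\<bar> * \<bar>b\<bar>) \<le> a\<^sup>2 + b\<^sup>2"
      by (simp add: power2_diff)
    moreover have "0 \<le> \<bar>a\<bar> * \<bar>b\<bar>" by simp
    ultimately show ?thesis unfolding abs_mult by linarith
  qed
  then show "AE w in M. norm (f w * g w) \<le> norm ((f w)\<^sup>2 + (g w)\<^sup>2)"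
    by simp
qed

lemma sq_integrable_funs_lincomb:
  assumes f: "f \<in> sq_integrable_funs M" and g: "g \<in> sq_integrable_funs M"
  shows "(\<lambda>w. a * f w + b * g w) \<in> sq_integrable_funs M"
proof -
  note [measurable] = sq_integrable_funsD(1)[OF f] sq_integrable_funsD(1)[OF g]
  have "integrable M (\<lambda>w. a\<^sup>2 * (f w)\<^sup>2 + b\<^sup>2 * (g w)\<^sup>2 + 2 * a * b * (f w * g w))"
    using sq_integrable_funsD(2)[OF f] sq_integrable_funsD(2)[OF g]
      integrable_mult_sq_integrable_funs[OF f g] by simp
  moreover have "a\<^sup>2 * (f w)\<^sup>2 + b\<^sup>2 * (g w)\<^sup>2 + 2 * a * b * (f w * g w) = (a * f w + b * g w)\<^sup>2" for w
    by (simp add: power2_eq_square algebra_simps)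
  ultimately show ?thesis
    by (simp add: sq_integrable_funs_def)
qed

lemma sq_integrable_funs_add:
  "f \<in> sq_integrable_funs M \<Longrightarrow> g \<in> sq_integrable_funs M \<Longrightarrow> (\<lambda>w. f w + g w) \<in> sq_integrable_funs M"
  using sq_integrable_funs_lincomb[of f M g 1 1] by simp

lemma sq_integrable_funs_diff:
  "f \<in> sq_integrable_funs M \<Longrightarrow> g \<in> sq_integrable_funs M \<Longrightarrow> (\<lambda>w. f w - g w) \<in> sq_integrable_funs M"
  using sq_integrable_funs_lincomb[of f M g 1 "-1"] by simp

lemma sq_integrable_funs_bound:
  assumes g: "g \<in> sq_integrable_funs M" and f: "f \<in> borel_measurable M"
    and le: "\<And>w. w \<in> space M \<Longrightarrow> \<bar>f w\<bar> \<le> \<bar>g w\<bar>"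
  shows "f \<in> sq_integrable_funs M"
proof -
  have "integrable M (\<lambda>w. (f w)\<^sup>2)"
    by (rule Bochner_Integration.integrable_bound[OF sq_integrable_funsD(2)[OF g]])
       (use f le in \<open>auto simp: abs_le_square_iff\<close>)
  with f show ?thesis by (simp add: sq_integrable_funs_def)
qed

text \<open>Linear growth makes \<open>c * z\<close> a square-integrable majorant; a uniform bound
  makes the constant \<open>c\<close> one, and there the finiteness of the measure enters.\<close>

lemma sq_integrable_funs_comp_growth:
  assumes "finite_measure M" and z: "z \<in> sq_integrable_funs M"
    and h: "h \<in> borel_measurable borel" and c: "0 \<le> c"
    and bound: "(\<forall>u. \<bar>h u\<bar> \<le> c * \<bar>u\<bar>) \<or> (\<forall>u. \<bar>h u\<bar> \<le> c)"
  shows "(\<lambda>w. h (z w)) \<in> sq_integrable_funs M"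
proof -
  interpret finite_measure M by fact
  have hz: "(\<lambda>w. h (z w)) \<in> borel_measurable M"
    using sq_integrable_funsD(1)[OF z] h by (rule measurable_compose)
  have lin: "(\<lambda>w. c * z w) \<in> sq_integrable_funs M"
    using sq_integrable_funs_lincomb[OF z z, of c 0] by simp
  have const: "(\<lambda>w. c) \<in> sq_integrable_funs M"
    by (simp add: sq_integrable_funs_def)
  show ?thesis
    using bound
  proof
    assume "\<forall>u. \<bar>h u\<bar> \<le> c * \<bar>u\<bar>"
    then show ?thesis
      using c by (intro sq_integrable_funs_bound[OF lin hz]) (simp add: abs_mult)
  next
    assume "\<forall>u. \<bar>h u\<bar> \<le> c"
    then show ?thesis
      using c by (intro sq_integrable_funs_bound[OF const hz]) simp
  qed
qed

section \<open>Extended real expectations\<close>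

text \<open>Both parts of an integrable function have finite integrals, so their extended difference
  is a genuine real difference. This allows the descent estimate to be done with Bochner
  integrals.\<close>

lemma ereal_expectation_eq_integral:
  fixes g :: "'a \<Rightarrow> ereal" and u :: "'a \<Rightarrow> real"
  assumes u: "integrable M u" and eq: "AE w in M. g w = ereal (u w)"
  shows "ereal_expectation M g = ereal (\<integral>w. u w \<partial>M)"
proof -
  have "(\<integral>\<^sup>+ w. e2ennreal (g w) \<partial>M) = (\<integral>\<^sup>+ w. ennreal (u w) \<partial>M)"
    using eq by (intro nn_integral_cong_AE) auto
  moreover have "(\<integral>\<^sup>+ w. e2ennreal (- g w) \<partial>M) = (\<integral>\<^sup>+ w. ennreal (- u w) \<partial>M)"
    using eq by (intro nn_integral_cong_AE) auto
  moreover obtain p q where pq: "0 \<le> p" "0 \<le> q"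
      "(\<integral>\<^sup>+ w. ennreal (u w) \<partial>M) = ennreal p" "(\<integral>\<^sup>+ w. ennreal (- u w) \<partial>M) = ennreal q"
      "(\<integral>w. u w \<partial>M) = p - q"
    using u by (auto elim: integrableE)
  ultimately show ?thesis
    by (simp add: ereal_expectation_def enn2ereal_ennreal)
qed

text \<open>The lower bound and the finite measure keep the negative part finite. An expectation
  other than \<infinity> then forces the positive part to have finite integral, hence
  \<open>g\<close> to be real almost everywhere and integrable.\<close>

lemma ereal_expectation_not_PInf:
  fixes g :: "'a \<Rightarrow> ereal"
  assumes "finite_measure M" and g [measurable]: "g \<in> borel_measurable M"
    and b: "\<And>w. w \<in> space M \<Longrightarrow> ereal b \<le> g w" and fin: "ereal_expectation M g \<noteq> \<infinity>"
  obtains u where "integrable M u" "AE w in M. g w = ereal (u w)"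
proof
  interpret finite_measure M by fact
  let ?u = "\<lambda>w. real_of_ereal (g w)"
  have neg: "(\<integral>\<^sup>+ w. e2ennreal (- g w) \<partial>M) < \<infinity>"
  proof -
    \<comment> \<open>For \<open>b\<close> nonnegative the right-hand side is truncated to 0, in
      agreement with a vanishing negative part.\<close>
    have "e2ennreal (- g w) \<le> ennreal (- b)" if "w \<in> space M" for w
    proof -
      have "- g w \<le> - ereal b"
        using b[OF that] by (simp only: ereal_minus_le_minus)
      from e2ennreal_mono[OF this] show ?thesis by simp
    qed
    then have "(\<integral>\<^sup>+ w. e2ennreal (- g w) \<partial>M) \<le> (\<integral>\<^sup>+ w. ennreal (- b) \<partial>M)"
      by (intro nn_integral_mono)
    also have "\<dots> < \<infinity>"
      by (simp add: ennreal_mult_less_top emeasure_finite top.not_eq_extremum[symmetric] ennreal_mult_eq_top_iff)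
    finally show ?thesis .
  qed
  \<comment> \<open>Otherwise the expectation would be \<infinity> minus a finite number, that is
    \<infinity>.\<close>
  have pos: "(\<integral>\<^sup>+ w. e2ennreal (g w) \<partial>M) \<noteq> \<infinity>"
    using fin neg by (cases "\<integral>\<^sup>+ w. e2ennreal (- g w) \<partial>M") (auto simp: ereal_expectation_def enn2ereal_ennreal)
  have "AE w in M. e2ennreal (g w) \<noteq> \<infinity>"
    using pos by (intro nn_integral_PInf_AE) auto
  then show eq: "AE w in M. g w = ereal (?u w)"
  proof (rule AE_mp, intro AE_I2 impI)
    fix w assume "w \<in> space M" "e2ennreal (g w) \<noteq> \<infinity>"
    with b[of w] show "g w = ereal (?u w)"
      by (cases "g w") auto
  qed
  have "(\<integral>\<^sup>+ w. ennreal (?u w) \<partial>M) = (\<integral>\<^sup>+ w. e2ennreal (g w) \<partial>M)"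
    by (rule nn_integral_cong_AE, rule AE_mp[OF eq], intro AE_I2 impI) (metis e2ennreal_ereal)
  moreover have "(\<integral>\<^sup>+ w. ennreal (- ?u w) \<partial>M) = (\<integral>\<^sup>+ w. e2ennreal (- g w) \<partial>M)"
    by (rule nn_integral_cong_AE, rule AE_mp[OF eq], intro AE_I2 impI)
       (metis e2ennreal_ereal uminus_ereal.simps(1))
  ultimately show "integrable M ?u"
    using pos neg by (simp add: real_integrable_def)
qed

section \<open>Isotropic distributions\<close>

text \<open>This isolates what the descent argument uses about the law of \<open>w\<close>: the
  second-moment matrix is the identity. Measurability of the identity is stated separately because
  the sphere carries the trace of the Borel sets and not the Borel sets of the whole space.\<close>

locale isotropic = prob_space M for M :: "(real ^ 'n) measure" +
  assumes id_measurable [measurable]: "(\<lambda>w. w) \<in> borel_measurable M"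
    and integrable_coords: "\<And>i j. integrable M (\<lambda>w. w $ i * w $ j)"
    and integral_coords: "\<And>i j. (\<integral>w. w $ i * w $ j \<partial>M) = (if i = j then 1 else 0)"
begin

lemma inner_mult_inner:
  "(w \<bullet> u) * (w \<bullet> v) = (\<Sum>i\<in>UNIV. \<Sum>j\<in>UNIV. (u $ i * v $ j) * (w $ i * w $ j))"
  for u v w :: "real ^ 'n"
  by (simp add: inner_vec_def sum_product mult_ac)

lemma integrable_inner_mult_inner: "integrable M (\<lambda>w. (w \<bullet> u) * (w \<bullet> v))"
  unfolding inner_mult_inner using integrable_coords by simp

lemma integral_inner_mult_inner: "(\<integral>w. (w \<bullet> u) * (w \<bullet> v) \<partial>M) = u \<bullet> v"
  unfolding inner_mult_inner
  by (simp add: integrable_coords integral_coords Bochner_Integration.integral_sum)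
     (simp add: inner_vec_def if_distrib cong: if_cong)

lemma meas_adj_sq_integrable: "meas_adj v \<in> sq_integrable_funs M"
proof -
  have "(\<lambda>w. w \<bullet> v) \<in> sq_integrable_funs M"
    using integrable_inner_mult_inner[of v v] by (simp add: sq_integrable_funs_def power2_eq_square)
  then show ?thesis by (simp add: meas_adj_def[abs_def])
qed

text \<open>Each coordinate is a product of two square-integrable functions. Hence
  \<open>meas_op\<close> is a true expectation on these functions and never the default value 0 of a
  divergent Bochner integral.\<close>

lemma integrable_scaleR_sq_integrable:
  assumes "f \<in> sq_integrable_funs M"
  shows "integrable M (\<lambda>w. f w *\<^sub>R w)"
proof -
  have "integrable M (\<lambda>w. \<Sum>b\<in>Basis. (f w * meas_adj b w) *\<^sub>R b)"
    using integrable_mult_sq_integrable_funs[OF assms meas_adj_sq_integrable] by simp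
  moreover have "(\<Sum>b\<in>Basis. (f w * meas_adj b w) *\<^sub>R b) = f w *\<^sub>R w" for w
    by (simp add: meas_adj_def euclidean_representation flip: scaleR_scaleR scaleR_sum_right)
  ultimately show ?thesis by simp
qed

lemma meas_op_inner:
  assumes "f \<in> sq_integrable_funs M"
  shows "meas_op M f \<bullet> v = (\<integral>w. f w * meas_adj v w \<partial>M)"
  using integral_inner_left[OF integrable_scaleR_sq_integrable[OF assms], of v]
  by (simp add: meas_op_def meas_adj_def)

lemma meas_op_diff:
  assumes "f \<in> sq_integrable_funs M" "g \<in> sq_integrable_funs M"
  shows "meas_op M (\<lambda>w. f w - g w) = meas_op M f - meas_op M g"
  using assms by (simp add: meas_op_def scaleR_left_diff_distrib integrable_scaleR_sq_integrable)

lemma integral_meas_adj_sq: "(\<integral>w. (meas_adj v w)\<^sup>2 \<partial>M) = (norm v)\<^sup>2"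
  using integral_inner_mult_inner[of v v]
  by (simp add: meas_adj_def power2_eq_square dot_square_norm[unfolded power2_eq_square])

text \<open>Expanding the square, adjointness evaluates the cross term and isotropy the last
  one.\<close>

lemma integral_diff_meas_adj_sq:
  assumes f: "f \<in> sq_integrable_funs M"
  shows "(\<integral>w. (f w - meas_adj v w)\<^sup>2 \<partial>M) =
    (\<integral>w. (f w)\<^sup>2 \<partial>M) - 2 * (meas_op M f \<bullet> v) + (norm v)\<^sup>2"
proof -
  have "(f w - meas_adj v w)\<^sup>2 = (f w)\<^sup>2 - 2 * (f w * meas_adj v w) + (meas_adj v w)\<^sup>2" for w
    by (simp add: power2_diff)
  then show ?thesis
    using sq_integrable_funsD(2)[OF f] sq_integrable_funsD(2)[OF meas_adj_sq_integrable[of v]]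
      integrable_mult_sq_integrable_funs[OF f meas_adj_sq_integrable[of v]]
    by (simp add: meas_op_inner[OF f] integral_meas_adj_sq)
qed

text \<open>This is Pythagoras: by isotropy \<open>meas_adj\<close> is an isometry and
  \<open>\<delta> - meas_adj (meas_op M \<delta>)\<close> is orthogonal to its range. The component
  in the range is the image of \<open>meas_op M \<delta> - (x - meas_op M f)\<close>, which is the
  negative of \<open>x - meas_op M g\<close>.\<close>

lemma integral_sq_decomposition:
  assumes f: "f \<in> sq_integrable_funs M" and g: "g \<in> sq_integrable_funs M"
  defines "\<delta> \<equiv> \<lambda>w. g w - f w"
  shows "(\<integral>w. (\<delta> w - meas_adj (x - meas_op M f) w)\<^sup>2 \<partial>M) =
    (norm (x - meas_op M g))\<^sup>2 + (\<integral>w. (\<delta> w - meas_adj (meas_op M \<delta>) w)\<^sup>2 \<partial>M)"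
proof -
  have \<delta>: "\<delta> \<in> sq_integrable_funs M"
    unfolding \<delta>_def using g f by (rule sq_integrable_funs_diff)
  have eq: "x - meas_op M g = (x - meas_op M f) - meas_op M \<delta>"
    unfolding \<delta>_def using f g by (simp add: meas_op_diff)
  show ?thesis
    unfolding integral_diff_meas_adj_sq[OF \<delta>] eq
    by (simp add: power2_norm_eq_inner inner_diff_left inner_diff_right inner_commute)
qed

text \<open>Integrating the pointwise proximal inequality requires \<phi> to be integrable along
  both functions. For \<open>f\<close> this follows from a finite expectation; for \<open>g\<close>
  it follows from the inequality itself together with the lower bound \<open>b\<close>.\<close>

lemma objective_prox_step:
  fixes f g :: "real ^ 'n \<Rightarrow> real" and \<phi> :: "real \<Rightarrow> ereal"
  assumes f: "f \<in> sq_integrable_funs M" and g: "g \<in> sq_integrable_funs M"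
    and \<phi> [measurable]: "\<phi> \<in> borel_measurable borel" and b: "\<And>u. ereal b \<le> \<phi> u"
    and h: "is_prox \<phi> h"
    and step: "\<And>w. w \<in> space M \<Longrightarrow> g w = h (meas_adj x w + f w - meas_adj (meas_op M f) w)"
  shows "objective M \<phi> x g \<le> objective M \<phi> x f
    - ereal (1/2 * (\<integral>w. (g w - f w - meas_adj (meas_op M (\<lambda>w. g w - f w)) w)\<^sup>2 \<partial>M))"
proof (cases "ereal_expectation M (\<lambda>w. \<phi> (f w)) = \<infinity>")
  \<comment> \<open>The right-hand side is then \<infinity> minus a real number, so there is nothing
    to prove.\<close>
  case True
  then show ?thesis by (simp add: objective_def)
next
  case False
  note [measurable] = sq_integrable_funsD(1)[OF f] sq_integrable_funsD(1)[OF g]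
  let ?r = "x - meas_op M f"
  let ?p = "\<lambda>w. (g w - f w - meas_adj ?r w)\<^sup>2"
  let ?q = "\<lambda>w. (meas_adj ?r w)\<^sup>2"
  obtain u where u: "integrable M u" and \<phi>f: "AE w in M. \<phi> (f w) = ereal (u w)"
    by (rule ereal_expectation_not_PInf[of M "\<lambda>w. \<phi> (f w)" b])
       (use False b finite_measure_axioms in auto)
  have p: "integrable M ?p" and q: "integrable M ?q"
    using sq_integrable_funs_diff[OF sq_integrable_funs_diff[OF g f] meas_adj_sq_integrable]
      meas_adj_sq_integrable by (auto dest: sq_integrable_funsD(2))
  have prox: "ereal (1/2 * ?p w) + \<phi> (g w) \<le> ereal (1/2 * ?q w) + \<phi> (f w)"
    if w: "w \<in> space M" for w
  proof -
    let ?z = "meas_adj x w + f w - meas_adj (meas_op M f) w"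
    \<comment> \<open>The old value \<open>f w\<close> is the competitor against the minimizer
      \<open>g w\<close>.\<close>
    have "ereal (1/2 * (g w - ?z)\<^sup>2) + \<phi> (g w) \<le> ereal (1/2 * (f w - ?z)\<^sup>2) + \<phi> (f w)"
      using h unfolding is_prox_def is_arg_min_def step[OF w] not_less[symmetric] by blast
    moreover have "g w - ?z = g w - f w - meas_adj ?r w" and "f w - ?z = - meas_adj ?r w"
      by (simp_all add: meas_adj_def inner_diff_right)
    ultimately show ?thesis by simp
  qed
  let ?v = "\<lambda>w. real_of_ereal (\<phi> (g w))"
  \<comment> \<open>Where \<open>\<phi> (f w)\<close> is real, the proximal inequality excludes
    \<infinity> for \<open>\<phi> (g w)\<close> and \<open>b\<close> excludes -\<infinity>. The
    default value of \<open>real_of_ereal\<close> at infinite arguments therefore matters only on a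
    null set.\<close>
  have \<phi>g: "AE w in M. \<phi> (g w) = ereal (?v w) \<and> b \<le> ?v w \<and>
      1/2 * ?p w + ?v w \<le> 1/2 * ?q w + u w"
    using \<phi>f
  proof (rule AE_mp, intro AE_I2 impI)
    fix w assume "w \<in> space M" and "\<phi> (f w) = ereal (u w)"
    with prox[of w] b[of "g w"]
    show "\<phi> (g w) = ereal (?v w) \<and> b \<le> ?v w \<and> 1/2 * ?p w + ?v w \<le> 1/2 * ?q w + u w"
      by (cases "\<phi> (g w)") auto
  qed
  \<comment> \<open>Dropping the nonnegative \<open>?p\<close> squeezes \<open>?v\<close> between
    \<open>b\<close> and \<open>1/2 * ?q + u\<close>, which are both integrable.\<close>
  have v: "integrable M ?v"
  proof (rule Bochner_Integration.integrable_bound)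
    show "integrable M (\<lambda>w. \<bar>b\<bar> + 1/2 * ?q w + \<bar>u w\<bar>)"
      using q u by simp
    show "AE w in M. norm (?v w) \<le> norm (\<bar>b\<bar> + 1/2 * ?q w + \<bar>u w\<bar>)"
      using \<phi>g
    proof (rule AE_mp, intro AE_I2 impI)
      fix w
      assume "\<phi> (g w) = ereal (?v w) \<and> b \<le> ?v w \<and> 1/2 * ?p w + ?v w \<le> 1/2 * ?q w + u w"
      moreover have "0 \<le> ?p w" "0 \<le> ?q w" by simp_all
      ultimately show "norm (?v w) \<le> norm (\<bar>b\<bar> + 1/2 * ?q w + \<bar>u w\<bar>)"
        unfolding real_norm_def by linarith
    qed
  qed measurable
  have "(\<integral>w. 1/2 * ?p w + ?v w \<partial>M) \<le> (\<integral>w. 1/2 * ?q w + u w \<partial>M)"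
    using p q u v \<phi>g by (intro integral_mono_AE) auto
  \<comment> \<open>By isotropy the integral of \<open>?q\<close> is the squared residual at
    \<open>f\<close>. The integral of \<open>?p\<close> is split below into the squared residual at
    \<open>g\<close> and the claimed decrease.\<close>
  then have "1/2 * (\<integral>w. ?p w \<partial>M) + (\<integral>w. ?v w \<partial>M) \<le> 1/2 * (norm ?r)\<^sup>2 + (\<integral>w. u w \<partial>M)"
    using p q u v by (simp add: integral_meas_adj_sq)
  moreover have "ereal_expectation M (\<lambda>w. \<phi> (f w)) = ereal (\<integral>w. u w \<partial>M)"
    by (rule ereal_expectation_eq_integral[OF u \<phi>f])
  moreover have "ereal_expectation M (\<lambda>w. \<phi> (g w)) = ereal (\<integral>w. ?v w \<partial>M)"
    using \<phi>g by (intro ereal_expectation_eq_integral[OF v]) auto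
  ultimately show ?thesis
    unfolding objective_def integral_sq_decomposition[OF f g, of x] by simp argo
qed

end

section \<open>Isotropy of the two input distributions\<close>

lemma integral_std_normal_density_powers:
  "integrable lborel (\<lambda>y. std_normal_density y * (if P then y else 1) * (if Q then y else 1))"
  "(\<integral>y. std_normal_density y * (if P then y else 1) * (if Q then y else 1) \<partial>lborel) =
    (if P = Q then 1 else 0)"
proof -
  \<comment> \<open>Counting how many of the two conditions hold merges all cases into the normal
    moments of order 0, 1 and 2, with values 1, 0 and 1.\<close>
  let ?n = "of_bool P + of_bool Q :: nat"
  have eq: "std_normal_density y * (if P then y else 1) * (if Q then y else 1) =
      std_normal_density y * y ^ ?n" for y
    by (cases P; cases Q) simp_all
  show "integrable lborel (\<lambda>y. std_normal_density y * (if P then y else 1) * (if Q then y else 1))"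
    unfolding eq by (rule integrable_std_normal_moment)
  have 0: "(\<integral>y. std_normal_density y * y ^ 0 \<partial>lborel) = 1"
    using integral_std_normal_moment_even[of 0] by simp
  have 1: "(\<integral>y. std_normal_density y * y ^ 1 \<partial>lborel) = 0"
    using integral_std_normal_moment_odd[of 0] by simp
  have 2: "(\<integral>y. std_normal_density y * y ^ 2 \<partial>lborel) = 1"
    using integral_std_normal_moment_even[of 1] by simp
  have "?n = 0 \<and> P = Q \<or> ?n = 1 \<and> P \<noteq> Q \<or> ?n = 2 \<and> P = Q"
    by (cases P; cases Q) simp_all
  then show "(\<integral>y. std_normal_density y * (if P then y else 1) * (if Q then y else 1) \<partial>lborel) =
    (if P = Q then 1 else 0)"
    unfolding eq using 0 1 2 by (elim disjE conjE) (simp_all only: if_True if_False simp_thms)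
qed

text \<open>The density times \<open>w $ i * w $ j\<close> is a product of functions of single
  coordinates, so its integral over the product measure factors into one-dimensional
  moments.\<close>

lemma std_gaussian_second_moments:
  fixes i j :: "'n :: finite"
  shows "integrable std_gaussian (\<lambda>w :: real ^ 'n. w $ i * w $ j)"
    and "(\<integral>w. w $ i * w $ j \<partial>(std_gaussian :: (real ^ 'n) measure)) = (if i = j then 1 else 0)"
proof -
  let ?b = "\<lambda>i. axis i 1 :: real ^ 'n"
  let ?P = "\<Pi>\<^sub>M b\<in>(Basis :: (real ^ 'n) set). (lborel :: real measure)"
  \<comment> \<open>The factor in direction \<open>b\<close> picks up one power of \<open>y\<close>
    for each of \<open>i\<close> and \<open>j\<close> whose axis is \<open>b\<close>. The map
    \<open>?T\<close> reassembles a vector from its coordinates and carries the product measure to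
    \<open>lborel\<close>.\<close>
  let ?k = "\<lambda>b y. std_normal_density y * (if b = ?b i then y else 1) * (if b = ?b j then y else 1)"
  let ?T = "\<lambda>f. \<Sum>b\<in>Basis. f b *\<^sub>R b :: real ^ 'n"
  interpret product_sigma_finite "\<lambda>b :: real ^ 'n. lborel :: real measure"
    by standard
  have inj: "inj ?b"
    by (auto intro!: injI simp: axis_eq_axis)
  have Basis_eq: "(Basis :: (real ^ 'n) set) = range ?b"
    by (auto simp: Basis_vec_def)
  have dens_eq: "(\<Prod>l\<in>UNIV. std_normal_density (w $ l)) = (\<Prod>b\<in>Basis. std_normal_density (w \<bullet> b))"
    for w :: "real ^ 'n"
    unfolding Basis_eq using inj by (simp add: prod.reindex inner_axis)
  have coord: "(\<Prod>b\<in>Basis. if b = ?b l then w \<bullet> b else 1) = w $ l" for w :: "real ^ 'n" and l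
    unfolding Basis_eq by (subst prod.delta) (auto simp: inner_axis)
  have prod_eq: "(\<Prod>l\<in>UNIV. std_normal_density (w $ l)) *\<^sub>R (w $ i * w $ j) =
      (\<Prod>b\<in>Basis. ?k b (w \<bullet> b))" for w :: "real ^ 'n"
    unfolding prod.distrib coord dens_eq by (simp add: mult.assoc)
  have T: "?T \<in> ?P \<rightarrow>\<^sub>M borel"
    by measurable
  have m: "(\<lambda>w :: real ^ 'n. \<Prod>b\<in>Basis. ?k b (w \<bullet> b)) \<in> borel_measurable borel"
    by measurable
  have meas: "(\<lambda>w :: real ^ 'n. \<Prod>l\<in>UNIV. std_normal_density (w $ l)) \<in> borel_measurable lborel"
    unfolding dens_eq by measurable
  have nonneg: "AE w :: real ^ 'n in lborel. 0 \<le> (\<Prod>l\<in>UNIV. std_normal_density (w $ l))"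
    by (simp add: prod_nonneg)
  have pull: "(\<Prod>b\<in>Basis. ?k b (?T f \<bullet> b)) = (\<Prod>b\<in>Basis. ?k b (f b))" for f
    by (rule prod.cong) auto
  have "integrable ?P (\<lambda>f. \<Prod>b\<in>Basis. ?k b (f b))"
    by (rule product_integrable_prod) (auto intro: integral_std_normal_density_powers)
  then have "integrable lborel (\<lambda>w :: real ^ 'n. \<Prod>b\<in>Basis. ?k b (w \<bullet> b))"
    unfolding lborel_eq[where 'a = "real ^ 'n"] integrable_distr_eq[OF T m] pull .
  then show "integrable std_gaussian (\<lambda>w :: real ^ 'n. w $ i * w $ j)"
    unfolding std_gaussian_def
    by (subst integrable_density[OF _ meas nonneg]) (simp_all only: prod_eq, measurable)
  have "(\<integral>w. w $ i * w $ j \<partial>(std_gaussian :: (real ^ 'n) measure)) =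
      (\<integral>w. (\<Prod>b\<in>Basis. ?k b ((w :: real ^ 'n) \<bullet> b)) \<partial>lborel)"
    unfolding std_gaussian_def
    by (subst integral_density[OF _ meas nonneg]) (simp_all only: prod_eq, measurable)
  also have "\<dots> = (\<integral>f. (\<Prod>b\<in>Basis. ?k b (f b)) \<partial>?P)"
    unfolding lborel_eq[where 'a = "real ^ 'n"] integral_distr[OF T m] pull ..
  also have "\<dots> = (\<Prod>b\<in>(Basis :: (real ^ 'n) set). \<integral>y. ?k b y \<partial>lborel)"
    by (rule product_integral_prod) (auto intro: integral_std_normal_density_powers)
  also have "\<dots> = (\<Prod>b\<in>(Basis :: (real ^ 'n) set). if (b = ?b i) = (b = ?b j) then 1 else 0)"
    by (simp only: integral_std_normal_density_powers(2))
  \<comment> \<open>For distinct indices the direction \<open>?b i\<close> contributes a vanishing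
    first moment; for equal indices every factor is 1.\<close>
  also have "\<dots> = (if i = j then 1 else 0)"
    unfolding Basis_eq by (auto simp: axis_eq_axis prod_zero_iff)
  finally show "(\<integral>w. w $ i * w $ j \<partial>(std_gaussian :: (real ^ 'n) measure)) = (if i = j then 1 else 0)" .
qed

lemma isotropic_std_gaussian: "isotropic (std_gaussian :: (real ^ 'n) measure)"
  by (intro isotropic.intro isotropic_axioms.intro prob_space_std_gaussian std_gaussian_second_moments)
     (simp add: measurable_cong_sets[OF sets_std_gaussian refl])

section \<open>Second moments of the uniform distribution on the sphere\<close>

lemma id_measurable_sphere_uniform: "(\<lambda>w. w) \<in> borel_measurable (sphere_uniform :: (real ^ 'n) measure)"
  by (simp add: measurable_cong_sets[OF sets_sphere_uniform refl] measurable_restrict_space1)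

lemma integrable_sphere_uniform_coords:
  "integrable sphere_uniform (\<lambda>w :: real ^ 'n. w $ i * w $ j)"
proof -
  interpret prob_space "sphere_uniform :: (real ^ 'n) measure"
    by (rule prob_space_sphere_uniform)
  have meas: "(\<lambda>w :: real ^ 'n. w $ i * w $ j) \<in> borel_measurable borel"
    by measurable
  show ?thesis
  proof (rule integrable_const_bound)
    show "AE w :: real ^ 'n in sphere_uniform. norm (w $ i * w $ j) \<le> real CARD('n)"
    proof (rule AE_I2)
      fix w :: "real ^ 'n" assume "w \<in> space sphere_uniform"
      then have "norm w = sqrt (real CARD('n))"
        by (simp add: space_sphere_uniform)
      then have "\<bar>w $ l\<bar> \<le> sqrt (real CARD('n))" for l
        using component_le_norm_cart[of w l] by simp
      then have "\<bar>w $ i\<bar> * \<bar>w $ j\<bar> \<le> sqrt (real CARD('n)) * sqrt (real CARD('n))"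
        by (intro mult_mono) auto
      then show "norm (w $ i * w $ j) \<le> real CARD('n)"
        by (simp add: abs_mult)
    qed
  qed (rule measurable_compose[OF id_measurable_sphere_uniform meas])
qed

lemma integral_sphere_uniform_orthogonal:
  fixes T :: "real ^ 'n \<Rightarrow> real ^ 'n" and g :: "real ^ 'n \<Rightarrow> real"
  assumes T: "orthogonal_transformation T" and g: "g \<in> borel_measurable borel"
  shows "(\<integral>w. g (T w) \<partial>sphere_uniform) = (\<integral>w. g w \<partial>sphere_uniform)"
proof -
  let ?S = "sphere 0 (sqrt (real CARD('n))) :: (real ^ 'n) set"
  have mT: "T \<in> sphere_uniform \<rightarrow>\<^sub>M sphere_uniform"
    unfolding measurable_cong_sets[OF sets_sphere_uniform sets_sphere_uniform]
    using orthogonal_transformation_borel_measurable[OF T] T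
    by (intro measurable_restrict_space3) (auto simp: orthogonal_transformation_norm)
  have mg: "g \<in> borel_measurable sphere_uniform"
    using id_measurable_sphere_uniform g by (rule measurable_compose)
  show ?thesis
    using integral_distr[OF mT mg] by (simp add: sphere_uniform_invariant[OF T])
qed

text \<open>Symmetry replaces computation: a reflection kills the off-diagonal moments,
  transpositions make the diagonal ones equal, and the radius fixes their sum.\<close>

lemma sphere_uniform_second_moments:
  fixes i j :: "'n :: finite"
  shows "(\<integral>w. w $ i * w $ j \<partial>(sphere_uniform :: (real ^ 'n) measure)) = (if i = j then 1 else 0)"
proof -
  let ?M = "sphere_uniform :: (real ^ 'n) measure"
  interpret prob_space ?M
    by (rule prob_space_sphere_uniform)
  have meas: "(\<lambda>w :: real ^ 'n. w $ k * w $ l) \<in> borel_measurable borel" for k l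
    by measurable
  show ?thesis
  proof (cases "i = j")
    case False
    \<comment> \<open>Flipping the sign of coordinate \<open>i\<close> alone negates the integrand,
      so the integral equals its own negative.\<close>
    let ?T = "\<lambda>w :: real ^ 'n. \<chi> k. if k = i then - w $ k else w $ k"
    have "orthogonal_transformation ?T"
      unfolding orthogonal_transformation_def
      by (auto intro!: linearI sum.cong simp: vec_eq_iff inner_vec_def algebra_simps)
    from integral_sphere_uniform_orthogonal[OF this meas[of i j]] False show ?thesis
      by simp
  next
    case True
    have swap: "(\<integral>w. w $ k * w $ k \<partial>?M) = (\<integral>w. w $ i * w $ i \<partial>?M)" for k
    proof -
      let ?p = "Transposition.transpose i k"
      let ?T = "\<lambda>w :: real ^ 'n. \<chi> l. w $ ?p l"
      have "(\<Sum>l\<in>UNIV. v $ ?p l * w $ ?p l) = (\<Sum>l\<in>UNIV. v $ l * w $ l)" for v w :: "real ^ 'n"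
        by (rule sum.reindex_bij_betw) (rule bij_transpose)
      then have "orthogonal_transformation ?T"
        unfolding orthogonal_transformation_def
        by (auto intro!: linearI simp: vec_eq_iff inner_vec_def)
      from integral_sphere_uniform_orthogonal[OF this meas[of i i]] show ?thesis
        by simp
    qed
    \<comment> \<open>The d equal moments sum to the expectation of the squared norm, which is d on
      the sphere of radius sqrt d; so each moment is 1.\<close>
    have "real CARD('n) * (\<integral>w. w $ i * w $ i \<partial>?M) = (\<Sum>k\<in>(UNIV :: 'n set). \<integral>w. w $ k * w $ k \<partial>?M)"
      by (subst swap) simp
    also have "\<dots> = (\<integral>w. (\<Sum>k\<in>UNIV. w $ k * w $ k) \<partial>?M)"
      by (rule Bochner_Integration.integral_sum[symmetric]) (rule integrable_sphere_uniform_coords)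
    also have "\<dots> = (\<integral>w. real CARD('n) \<partial>?M)"
    proof (rule Bochner_Integration.integral_cong[OF refl])
      fix w assume "w \<in> space ?M"
      then have "norm w = sqrt (real CARD('n))"
        by (simp add: space_sphere_uniform)
      then have "w \<bullet> w = real CARD('n)"
        by (simp add: dot_square_norm)
      then show "(\<Sum>k\<in>UNIV. w $ k * w $ k) = real CARD('n)"
        by (simp add: inner_vec_def)
    qed
    also have "\<dots> = real CARD('n)"
      using prob_space by simp
    finally show ?thesis
      using True by simp
  qed
qed

lemma isotropic_sphere_uniform: "isotropic (sphere_uniform :: (real ^ 'n) measure)"
  by (intro isotropic.intro isotropic_axioms.intro prob_space_sphere_uniform
      id_measurable_sphere_uniform integrable_sphere_uniform_coords sphere_uniform_second_moments)

section \<open>Descent along the whole iteration\<close>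

theorem theorem1:
  fixes M :: "(real ^ 'n) measure"
    and \<phi> :: "real \<Rightarrow> ereal" and h :: "real \<Rightarrow> real" and c :: real
    and x :: "real ^ 'n" and f :: "nat \<Rightarrow> real ^ 'n \<Rightarrow> real"
  assumes "M = std_gaussian \<or> M = sphere_uniform"
    and "is_regularizer M \<phi>"
    and "is_prox \<phi> h"
    and "0 < c"
    and "(\<forall>z. \<bar>h z\<bar> \<le> c * \<bar>z\<bar>) \<or> (\<forall>z. \<bar>h z\<bar> \<le> c)"
    and "f 0 \<in> sq_integrable_funs M"
    and "\<And>t w. w \<in> space M \<Longrightarrow>
           f (Suc t) w = h (meas_adj x w + f t w - meas_adj (meas_op M (f t)) w)"
  shows "\<forall>t. objective M \<phi> x (f (Suc t))
               \<le> objective M \<phi> x (f t)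
                 - ereal (1/2 * (\<integral>w. (f (Suc t) w - f t w
                     - meas_adj (meas_op M (\<lambda>w'. f (Suc t) w' - f t w')) w)\<^sup>2 \<partial>M))
           \<and> objective M \<phi> x (f t)
                 - ereal (1/2 * (\<integral>w. (f (Suc t) w - f t w
                     - meas_adj (meas_op M (\<lambda>w'. f (Suc t) w' - f t w')) w)\<^sup>2 \<partial>M))
               \<le> objective M \<phi> x (f t)"
proof -
  interpret isotropic M
    using assms(1) isotropic_std_gaussian isotropic_sphere_uniform by blast
  obtain b where \<phi>: "\<phi> \<in> borel_measurable borel" "\<And>u. ereal b \<le> \<phi> u"
    using assms(2) by (auto simp: is_regularizer_def)
  have h: "h \<in> borel_measurable borel"
    using assms(3) by (simp add: is_prox_def)
  \<comment> \<open>The one-step estimate needs both iterates to be square integrable. The argument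
    of \<open>h\<close> stays in this space by linearity, and the growth condition carries the
    property through \<open>h\<close>.\<close>
  have L2: "f t \<in> sq_integrable_funs M" for t
  proof (induction t)
    case 0
    show ?case by fact
  next
    case (Suc t)
    have "(\<lambda>w. meas_adj x w + f t w - meas_adj (meas_op M (f t)) w) \<in> sq_integrable_funs M"
      by (intro sq_integrable_funs_diff sq_integrable_funs_add meas_adj_sq_integrable Suc)
    from sq_integrable_funs_comp_growth[OF finite_measure_axioms this h _ assms(5)] assms(4)
    have "(\<lambda>w. h (meas_adj x w + f t w - meas_adj (meas_op M (f t)) w)) \<in> sq_integrable_funs M"
      by simp
    \<comment> \<open>The recursion is given only on \<open>space M\<close>, so measurability is
      transferred by congruence on that space.\<close>
    moreover from this have "f (Suc t) \<in> borel_measurable M"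
      by (subst measurable_cong[OF assms(7)]) (auto dest: sq_integrable_funsD(1))
    ultimately show ?case
      by (rule sq_integrable_funs_bound) (simp add: assms(7))
  qed
  \<comment> \<open>A nonnegative real is subtracted; the case split covers an infinite
    objective.\<close>
  have sub: "a - ereal (1/2 * (\<integral>w. (k w)\<^sup>2 \<partial>M)) \<le> a" for a and k :: "real ^ 'n \<Rightarrow> real"
    by (cases a) simp_all
  show ?thesis
    by (intro allI conjI sub objective_prox_step[OF L2 L2 \<phi> assms(3)] assms(7))
qed

end
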